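(* Let $V$ be a two-dimensional real vector space equipped with a seminorm $|\cdot|_V$. For every set $X$, every $\sigma$-algebra $\Sigma$ on $X$ and every vector measure $\mu:\Sigma\to V$, $$|\mu|_V(X)=\tfrac12\,\mathrm{Per}_V(\mathcal{R}(\mu))$$ (and more generally $|\mu|_V(A)=\tfrac12\mathrm{Per}_V(\mathcal{R}_A(\mu))$ for every $A\in\Sigma$).
   Context: A vector measure is a countably additive map $\mu:\Sigma\to V$. Total variation: $|\mu|_V(A)=\sup\{\sum_{i=1}^m|\mu(E_i)|_V : E_1,\dots,E_m\in\Sigma \text{ pairwise disjoint subsets of } A\}$. Range: $\mathcal{R}_A(\mu)=\overline{\mathrm{conv}}\{\mu(E):E\in\Sigma,E\subseteq A\}$, $\mathcal{R}(\mu)=\mathcal{R}_X(\mu)$. Perimeter (with $\dim V=2$): for a convex polygon $P$ (convex hull of finitely many points) with vertices $v_1,\dots,v_\ell$ listed in cyclic order along its boundary, $\mathrm{Per}_V(P)=\sum_{i=1}^\ell|v_i-v_{i-1}|_V$ with $v_0=v_\ell$ (so a segment $[a,b]$ has perimeter $2|b-a|_V$); for a convex set $C\subseteq V$, $\mathrm{Per}_V(C)=\sup\{\mathrm{Per}_V(P): P\subseteq C \text{ a convex polygon}\}$. *)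

theory Defs
  imports "HOL-Analysis.Analysis"
begin

definition is_seminorm :: "('v::real_vector \<Rightarrow> real) \<Rightarrow> bool" where
  "is_seminorm N \<longleftrightarrow> (\<forall>x y. N (x + y) \<le> N x + N y) \<and> (\<forall>c x. N (c *\<^sub>R x) = \<bar>c\<bar> * N x)"

text \<open>Vector measure: countably additive map on a sigma algebra (convergence in the
  canonical topology of the finite-dimensional space).\<close>
definition vector_measure :: "'a set \<Rightarrow> 'a set set \<Rightarrow> ('a set \<Rightarrow> 'v::euclidean_space) \<Rightarrow> bool" where
  "vector_measure X \<Sigma> \<mu> \<longleftrightarrow> sigma_algebra X \<Sigma> \<and>
     (\<forall>E::nat \<Rightarrow> 'a set. range E \<subseteq> \<Sigma> \<longrightarrow> disjoint_family E \<longrightarrow>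
        (\<lambda>n. \<mu> (E n)) sums \<mu> (\<Union>n. E n))"

definition total_variation ::
  "('v::real_vector \<Rightarrow> real) \<Rightarrow> 'a set set \<Rightarrow> ('a set \<Rightarrow> 'v) \<Rightarrow> 'a set \<Rightarrow> ereal" where
  "total_variation N \<Sigma> \<mu> A =
     (SUP (E, m) \<in> {(E :: nat \<Rightarrow> 'a set, m :: nat).
                    (\<forall>i<m. E i \<in> \<Sigma> \<and> E i \<subseteq> A) \<and> disjoint_family_on E {..<m}}.
        ereal (\<Sum>i<m. N (\<mu> (E i))))"

definition vm_range :: "'a set set \<Rightarrow> ('a set \<Rightarrow> 'v::real_normed_vector) \<Rightarrow> 'a set \<Rightarrow> 'v set" where
  "vm_range \<Sigma> \<mu> A = closure (convex hull {\<mu> E | E. E \<in> \<Sigma> \<and> E \<subseteq> A})"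

definition convex_polygon :: "'v::real_vector set \<Rightarrow> bool" where
  "convex_polygon P \<longleftrightarrow> (\<exists>S. finite S \<and> P = convex hull S)"

text \<open>vs lists the vertices (extreme points) of P, each once, in cyclic order along the
  boundary: consecutive vertices (cyclically) span an edge (a face) of P.\<close>
definition cyclic_vertex_list :: "'v::euclidean_space set \<Rightarrow> 'v list \<Rightarrow> bool" where
  "cyclic_vertex_list P vs \<longleftrightarrow> distinct vs \<and> set vs = {v. v extreme_point_of P} \<and>
     (\<forall>i<length vs. closed_segment (vs ! ((i + length vs - 1) mod length vs)) (vs ! i) face_of P)"

definition cyclic_sum :: "('v::real_vector \<Rightarrow> real) \<Rightarrow> 'v list \<Rightarrow> real" where
  "cyclic_sum N vs = (\<Sum>i<length vs. N (vs ! i - vs ! ((i + length vs - 1) mod length vs)))"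

definition polygon_perimeter :: "('v::euclidean_space \<Rightarrow> real) \<Rightarrow> 'v set \<Rightarrow> real" where
  "polygon_perimeter N P = cyclic_sum N (SOME vs. cyclic_vertex_list P vs)"

definition perimeter :: "('v::euclidean_space \<Rightarrow> real) \<Rightarrow> 'v set \<Rightarrow> ereal" where
  "perimeter N C = (SUP P \<in> {P. convex_polygon P \<and> P \<subseteq> C}. ereal (polygon_perimeter N P))"

end

theory Submission
  imports Defs
begin

text \<open>A seminorm on the plane agrees on any given finite set of vectors with a positive
  combination of the seminorms \<open>\<lambda>w. \<bar>u \<bullet> w\<bar>\<close>. For the latter, the perimeter of a polygon is twice
  its width in direction \<open>u\<close>, because a line meets the boundary at most twice. So the perimeter is
  monotone, and the zonotope spanned by \<open>w\<^sub>1, \<dots>, w\<^sub>m\<close> has perimeter \<open>2 * (\<Sum>i. N w\<^sub>i)\<close>. The zonotope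
  spanned by the measures of disjoint sets lies in the range; conversely, up to \<open>\<epsilon>\<close>, every polygon
  in the range lies in such a zonotope, spanned by the atoms of a finite algebra of sets.\<close>

section \<open>Seminorms on finite sets of plane vectors\<close>

text \<open>The classical Crofton formula writes \<open>N\<close> once and for all as an integral of
  \<open>\<bar>u \<bullet> w\<bar>\<close> over directions \<open>u\<close>. Asking for agreement on
  finitely many vectors reduces this to the interpolation of a convex function of one variable at
  finitely many nodes. The price is that directions and weights depend on these vectors, so
  different polygons, or different values of \<epsilon>, need not share them. Each comparison
  therefore fixes one representation that covers the edges of the polygon together with all vectors
  it is compared with. The plane is essential for this representation: the maximum norm on
  three-dimensional space has none. Since the perimeter is read off a chosen vertex list, some list
  must be shown to exist, whereas the estimates are proved for every list.\<close>

text \<open>The interpolant is piecewise linear with slope \<open>- \<nu>\<close> before all nodes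
  and \<open>\<nu>\<close> beyond them, and \<open>d t\<close> is half its jump of slope at
  \<open>t\<close>. Convexity makes the inner jumps nonnegative, the Lipschitz bound the outer
  ones.\<close>

lemma convex_lipschitz_interpolation:
  fixes \<phi> :: "real \<Rightarrow> real"
  assumes "finite F" "F \<noteq> {}"
    and convex: "\<And>a b c. a < b \<Longrightarrow> b < c \<Longrightarrow> (\<phi> b - \<phi> a) * (c - b) \<le> (\<phi> c - \<phi> b) * (b - a)"
    and lipschitz: "\<And>s t. \<bar>\<phi> s - \<phi> t\<bar> \<le> \<nu> * \<bar>s - t\<bar>"
  shows "\<exists>d \<kappa>. (\<forall>t\<in>F. 0 \<le> d t) \<and> sum d F = \<nu> \<and> (\<forall>s\<in>F. \<phi> s = \<kappa> + (\<Sum>t\<in>F. d t * \<bar>s - t\<bar>))"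
proof -
  \<comment> \<open>The last conjunct says that the slope beyond the largest node is no larger than any
    later slope of \<open>\<phi>\<close>, which keeps the weights nonnegative when a node is added.\<close>
  have "F \<noteq> {} \<longrightarrow> (\<exists>d \<kappa>. (\<forall>t\<in>F. 0 \<le> d t) \<and> sum d F = \<nu> \<and>
      (\<forall>s\<in>F. \<phi> s = \<kappa> + (\<Sum>t\<in>F. d t * \<bar>s - t\<bar>)) \<and>
      (\<forall>c>Max F. (\<nu> - 2 * d (Max F)) * (c - Max F) \<le> \<phi> c - \<phi> (Max F)))"
    using \<open>finite F\<close>
  proof (induction rule: finite_linorder_max_induct)
    case empty
    then show ?case by simp
  next
    case (insert b F)
    show ?case
    proof (cases "F = {}")
      case True
      have "0 \<le> \<nu>" using lipschitz[of 0 1] by simp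
      moreover have "- \<nu> * (c - b) \<le> \<phi> c - \<phi> b" if "c > b" for c
        using lipschitz[of c b] that by (simp add: abs_le_iff)
      ultimately show ?thesis
        using True by (intro impI exI[of _ "\<lambda>_. \<nu>"] exI[of _ "\<phi> b"]) auto
    next
      case False
      define a where "a = Max F"
      obtain d \<kappa> where nonneg: "\<forall>t\<in>F. 0 \<le> d t" and total: "sum d F = \<nu>"
        and eq: "\<forall>s\<in>F. \<phi> s = \<kappa> + (\<Sum>t\<in>F. d t * \<bar>s - t\<bar>)"
        and slope: "\<forall>c>a. (\<nu> - 2 * d a) * (c - a) \<le> \<phi> c - \<phi> a"
        using insert False unfolding a_def by blast
      have a: "a \<in> F" and le_a: "t \<le> a" if "t \<in> F" for t
        using insert.hyps(1) False that by (simp_all add: a_def)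
      have aF: "a \<in> F" using a False by blast
      have ab: "a < b" using aF insert.hyps by blast
      have bF: "b \<notin> F" using insert.hyps by blast
      define \<sigma> where "\<sigma> = (\<phi> b - \<phi> a) / (b - a)"
      \<comment> \<open>The old interpolant has slope \<open>\<nu>\<close> beyond \<open>a\<close>.
        Moving weight \<open>\<delta>\<close> from \<open>a\<close> to \<open>b\<close> lowers the
        slope between them by \<open>2 * \<delta>\<close>, here to \<open>\<sigma>\<close>, and
        changes it nowhere else. Left of \<open>a\<close> the values rise by
        \<open>\<delta> * (b - a)\<close>, which the new constant term cancels.\<close>
      define \<delta> where "\<delta> = (\<nu> - \<sigma>) / 2"
      define d' where "d' = d(a := d a - \<delta>, b := \<delta>)"
      have \<sigma>: "\<phi> b - \<phi> a = \<sigma> * (b - a)" using ab by (simp add: \<sigma>_def)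
      have sum_F: "(\<Sum>t\<in>F. d t * g t) = d a * g a + (\<Sum>t\<in>F - {a}. d t * g t)" for g
        using insert.hyps(1) aF by (subst sum.remove[of F a]) auto
      have sum': "(\<Sum>t\<in>insert b F. d' t * g t) = (\<Sum>t\<in>F. d t * g t) + \<delta> * (g b - g a)" for g
      proof -
        have "(\<Sum>t\<in>insert b F. d' t * g t) = \<delta> * g b + (\<Sum>t\<in>F. d' t * g t)"
          using insert.hyps(1) bF by (simp add: d'_def)
        also have "(\<Sum>t\<in>F. d' t * g t) = (d a - \<delta>) * g a + (\<Sum>t\<in>F - {a}. d t * g t)"
        proof -
          have "(\<Sum>t\<in>F - {a}. d' t * g t) = (\<Sum>t\<in>F - {a}. d t * g t)"
            by (rule sum.cong) (use bF in \<open>auto simp: d'_def\<close>)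
          then show ?thesis
            using insert.hyps(1) aF ab by (subst sum.remove[of F a]) (auto simp: d'_def)
        qed
        finally show ?thesis by (simp add: sum_F algebra_simps)
      qed
      have "(\<nu> - 2 * d a) * (b - a) \<le> \<sigma> * (b - a)" using slope ab \<sigma> by auto
      then have "\<nu> - 2 * d a \<le> \<sigma>" using ab by simp
      moreover have "\<phi> b - \<phi> a \<le> \<nu> * (b - a)" using lipschitz[of b a] ab by (simp add: abs_le_iff)
      then have "\<sigma> * (b - a) \<le> \<nu> * (b - a)" by (simp only: \<sigma>)
      then have "\<sigma> \<le> \<nu>" using ab by simp
      ultimately have nonneg': "\<forall>t\<in>insert b F. 0 \<le> d' t"
        using nonneg by (auto simp: d'_def \<delta>_def)
      have total': "sum d' (insert b F) = \<nu>" using sum'[of "\<lambda>_. 1"] total by simp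
      have eq': "\<phi> s = \<kappa> - \<delta> * (b - a) + (\<Sum>t\<in>insert b F. d' t * \<bar>s - t\<bar>)" if "s \<in> insert b F" for s
      proof (cases "s = b")
        case True
        have "(\<Sum>t\<in>F. d t * \<bar>b - t\<bar>) - (\<Sum>t\<in>F. d t * \<bar>a - t\<bar>) = (\<Sum>t\<in>F. d t * (b - a))"
          unfolding sum_subtractf[symmetric]
          using le_a ab by (intro sum.cong) (auto simp: abs_if algebra_simps, fastforce+)
        also have "\<dots> = \<nu> * (b - a)" by (simp add: total sum_distrib_right[symmetric])
        finally have "(\<Sum>t\<in>F. d t * \<bar>b - t\<bar>) = \<phi> a - \<kappa> + \<nu> * (b - a)"
          using eq aF by simp
        then show ?thesis using True \<sigma> ab
          by (simp add: sum' \<delta>_def field_simps)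
      next
        case False
        then have "s \<in> F" "s \<le> a" using that le_a by auto
        then show ?thesis using eq ab by (simp add: sum' algebra_simps)
      qed
      have "Max (insert b F) = b"
        using insert.hyps False by (intro Max_eqI) auto
      moreover have "(\<nu> - 2 * d' b) * (c - b) \<le> \<phi> c - \<phi> b" if "b < c" for c
      proof -
        have "(\<sigma> * (c - b)) * (b - a) \<le> (\<phi> c - \<phi> b) * (b - a)"
          using convex[OF ab that] \<sigma> by (simp add: mult_ac)
        moreover have "\<nu> - 2 * d' b = \<sigma>" by (simp add: d'_def \<delta>_def field_simps)
        ultimately show ?thesis using ab by simp
      qed
      ultimately show ?thesis
        using nonneg' total' eq' by (intro impI exI[of _ d'] exI[of _ "\<kappa> - \<delta> * (b - a)"]) auto
    qed
  qed
  then show ?thesis using \<open>F \<noteq> {}\<close> by blast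
qed

lemma seminorm_zero: "is_seminorm N \<Longrightarrow> N 0 = 0"
  unfolding is_seminorm_def by (metis abs_zero mult_zero_left scaleR_zero_left)

lemma seminorm_uminus: "is_seminorm N \<Longrightarrow> N (- x) = N x"
  unfolding is_seminorm_def by (metis abs_minus_cancel abs_one mult_1 scaleR_minus1_left)

lemma seminorm_nonneg: "is_seminorm N \<Longrightarrow> 0 \<le> N x"
  using seminorm_zero[of N] seminorm_uminus[of N x] unfolding is_seminorm_def
  by (metis (no_types, opaque_lifting) add.right_inverse linorder_not_less add_neg_neg)

text \<open>The evenness of \<open>N\<close> makes the constant term of the one-dimensional interpolation along
  \<open>s \<mapsto> e + s *\<^sub>R f\<close> nonnegative; it becomes the weight of \<open>u = e\<close>.\<close>

lemma seminorm_finite_crofton: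
  fixes N :: "'v::euclidean_space \<Rightarrow> real"
  assumes dim: "DIM('v) = 2" and N: "is_seminorm N" and "finite W"
  obtains U c where "finite U" "\<And>u. u \<in> U \<Longrightarrow> 0 \<le> c u"
    "\<And>w. w \<in> W \<Longrightarrow> N w = (\<Sum>u\<in>U. c u * \<bar>u \<bullet> w\<bar>)"
proof -
  have tri: "N (x + y) \<le> N x + N y" and scale: "N (r *\<^sub>R x) = \<bar>r\<bar> * N x" for x y r
    using N by (auto simp: is_seminorm_def)
  obtain e f :: 'v where ef: "Basis = {e, f}" "e \<noteq> f"
    using dim by (auto simp: card_2_iff)
  have ort: "e \<bullet> e = 1" "f \<bullet> f = 1" "e \<bullet> f = 0" "f \<bullet> e = 0"
    using ef by (auto intro!: inner_same_Basis inner_not_same_Basis)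
  have expand: "w = (e \<bullet> w) *\<^sub>R e + (f \<bullet> w) *\<^sub>R f" for w
  proof -
    have "(\<Sum>b\<in>{e, f}. (b \<bullet> w) *\<^sub>R b) = w"
      unfolding ef(1)[symmetric] by (simp add: inner_commute[of _ w] euclidean_representation)
    then show ?thesis using ef(2) by simp
  qed
  define \<phi> where "\<phi> s = N (e + s *\<^sub>R f)" for s
  \<comment> \<open>The nodes are the slopes of the vectors of \<open>W\<close>. The extra
    \<open>0\<close> keeps \<open>F\<close> nonempty; vectors with \<open>e \<bullet> w = 0\<close>
    are served by \<open>sum d F = N f\<close> instead of a node.\<close>
  define F where "F = insert 0 ((\<lambda>w. (f \<bullet> w) / (e \<bullet> w)) ` W)"
  have F: "finite F" "F \<noteq> {}" using \<open>finite W\<close> by (auto simp: F_def)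
  have conv: "(\<phi> b - \<phi> a) * (c - b) \<le> (\<phi> c - \<phi> b) * (b - a)" if "a < b" "b < c" for a b c
  proof -
    have "(c - a) * \<phi> b = N ((c - a) *\<^sub>R (e + b *\<^sub>R f))"
      using that by (simp add: \<phi>_def scale)
    also have "(c - a) *\<^sub>R (e + b *\<^sub>R f) = (c - b) *\<^sub>R (e + a *\<^sub>R f) + (b - a) *\<^sub>R (e + c *\<^sub>R f)"
      by (simp add: algebra_simps)
    also have "N \<dots> \<le> (c - b) * \<phi> a + (b - a) * \<phi> c"
      using tri[of "(c - b) *\<^sub>R (e + a *\<^sub>R f)" "(b - a) *\<^sub>R (e + c *\<^sub>R f)"] that
      by (simp add: \<phi>_def scale)
    finally show ?thesis by (simp add: algebra_simps)
  qed
  have one_sided: "\<phi> s - \<phi> t \<le> N f * \<bar>s - t\<bar>" for s t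
  proof -
    have "\<phi> s = N ((e + t *\<^sub>R f) + (s - t) *\<^sub>R f)" by (simp add: \<phi>_def algebra_simps)
    also have "\<dots> \<le> \<phi> t + \<bar>s - t\<bar> * N f"
      using tri[of "e + t *\<^sub>R f" "(s - t) *\<^sub>R f"] by (simp add: \<phi>_def scale)
    finally show ?thesis by (simp add: mult.commute)
  qed
  have lip: "\<bar>\<phi> s - \<phi> t\<bar> \<le> N f * \<bar>s - t\<bar>" for s t
    using one_sided[of s t] one_sided[of t s] by (simp add: abs_minus_commute)
  obtain d \<kappa> where d: "\<forall>t\<in>F. 0 \<le> d t" "sum d F = N f"
    and eq: "\<forall>s\<in>F. \<phi> s = \<kappa> + (\<Sum>t\<in>F. d t * \<bar>s - t\<bar>)"
    using convex_lipschitz_interpolation[OF F conv lip] by blast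
  have "0 \<le> \<kappa>"
  proof -
    \<comment> \<open>Every node has total distance \<open>t - s\<close> from the two outermost
      ones, so comparing \<open>\<phi> s + \<phi> t\<close> with
      \<open>N ((t - s) *\<^sub>R f)\<close> leaves exactly \<open>2 * \<kappa>\<close>.\<close>
    define s t where "s = Min F" and "t = Max F"
    have st: "s \<in> F" "t \<in> F" "\<And>r. r \<in> F \<Longrightarrow> s \<le> r \<and> r \<le> t"
      using F by (auto simp: s_def t_def)
    have "\<phi> s + \<phi> t = 2 * \<kappa> + (\<Sum>r\<in>F. d r * \<bar>s - r\<bar> + d r * \<bar>t - r\<bar>)"
      using eq st by (simp add: sum.distrib)
    also have "(\<Sum>r\<in>F. d r * \<bar>s - r\<bar> + d r * \<bar>t - r\<bar>) = (\<Sum>r\<in>F. d r * (t - s))"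
    proof (rule sum.cong)
      fix r assume "r \<in> F"
      with st(3) have "\<bar>s - r\<bar> = r - s" "\<bar>t - r\<bar> = t - r" by fastforce+
      then show "d r * \<bar>s - r\<bar> + d r * \<bar>t - r\<bar> = d r * (t - s)" by (simp add: algebra_simps)
    qed simp
    also have "\<dots> = N f * (t - s)" by (simp add: d(2) sum_distrib_right[symmetric])
    finally have "\<phi> s + \<phi> t = 2 * \<kappa> + N f * (t - s)" .
    moreover have "N ((t - s) *\<^sub>R f) \<le> \<phi> t + \<phi> s"
      using tri[of "e + t *\<^sub>R f" "- (e + s *\<^sub>R f)"] seminorm_uminus[OF N, of "e + s *\<^sub>R f"]
      by (simp add: \<phi>_def algebra_simps)
    moreover have "s \<le> t" using st by blast
    ultimately show ?thesis by (simp add: scale mult.commute)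
  qed
  \<comment> \<open>Since \<open>g t \<bullet> (e + s *\<^sub>R f) = s - t\<close>, these directions
    produce the terms of the interpolation. The node is recovered from \<open>u = g t\<close> as
    \<open>- (u \<bullet> e)\<close>, which lets \<open>c\<close> be a function of
    \<open>u\<close>.\<close>
  define g where "g t = f - t *\<^sub>R e" for t
  define c where "c u = (if u = e then \<kappa> else d (- (u \<bullet> e)))" for u
  have cg: "c (g t) = d t" and g_ne: "g t \<noteq> e" for t
  proof -
    have "g t \<bullet> f = 1" "e \<bullet> f = 0" by (simp_all add: g_def ort inner_diff_left)
    then show "g t \<noteq> e" by auto
    then show "c (g t) = d t" by (simp add: c_def g_def ort inner_diff_left)
  qed
  have inj: "inj_on g F"
  proof (rule inj_onI)
    fix s t assume "g s = g t"
    then have "g s \<bullet> e = g t \<bullet> e" by simp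
    then show "s = t" by (simp add: g_def ort inner_diff_left)
  qed
  have "N w = (\<Sum>u\<in>insert e (g ` F). c u * \<bar>u \<bullet> w\<bar>)" if "w \<in> W" for w
  proof -
    have "(\<Sum>u\<in>insert e (g ` F). c u * \<bar>u \<bullet> w\<bar>) = \<kappa> * \<bar>e \<bullet> w\<bar> + (\<Sum>t\<in>F. d t * \<bar>g t \<bullet> w\<bar>)"
      using F g_ne by (subst sum.insert) (auto simp: sum.reindex[OF inj] cg, auto simp: c_def)
    also have "\<dots> = N w"
    proof (cases "e \<bullet> w = 0")
      case True
      then have "N w = \<bar>f \<bullet> w\<bar> * N f" using expand[of w] scale[of "f \<bullet> w" f] by simp
      then show ?thesis
        using True by (simp add: g_def inner_diff_left d(2)[symmetric] sum_distrib_right mult.commute)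
    next
      case False
      define s where "s = (f \<bullet> w) / (e \<bullet> w)"
      have s: "s \<in> F" using that by (auto simp: s_def F_def)
      have "w = (e \<bullet> w) *\<^sub>R (e + s *\<^sub>R f)"
        using False expand[of w] by (simp add: s_def scaleR_add_right)
      then have "N w = \<bar>e \<bullet> w\<bar> * \<phi> s" unfolding \<phi>_def by (metis scale)
      also have "\<dots> = \<kappa> * \<bar>e \<bullet> w\<bar> + (\<Sum>t\<in>F. d t * (\<bar>e \<bullet> w\<bar> * \<bar>s - t\<bar>))"
        using eq s by (simp add: algebra_simps sum_distrib_left)
      also have "g t \<bullet> w = (e \<bullet> w) * (s - t)" for t
        using False by (simp add: s_def g_def inner_diff_left field_simps)
      then have "(\<Sum>t\<in>F. d t * (\<bar>e \<bullet> w\<bar> * \<bar>s - t\<bar>)) = (\<Sum>t\<in>F. d t * \<bar>g t \<bullet> w\<bar>)"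
        by (simp add: abs_mult)
      finally show ?thesis by simp
    qed
    finally show ?thesis by simp
  qed
  moreover have "0 \<le> c u" if "u \<in> insert e (g ` F)" for u
    using that \<open>0 \<le> \<kappa>\<close> d(1) cg by (elim insertE imageE) (auto simp: c_def[of e])
  ultimately show thesis using F by (intro that[of "insert e (g ` F)" c]) auto
qed

section \<open>Finite algebras of sets\<close>

text \<open>The constant family of empty sets is disjoint, and a constant series converges only if
  its terms vanish.\<close>

lemma vector_measure_empty:
  assumes "vector_measure X \<Sigma> \<mu>"
  shows "\<mu> {} = 0"
proof -
  interpret sigma_algebra X \<Sigma> using assms by (simp add: vector_measure_def)
  have "(\<lambda>n::nat. \<mu> {}) sums \<mu> (\<Union>n::nat. {})"
    using assms by (auto simp: vector_measure_def disjoint_family_on_def)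
  then have "(\<lambda>n::nat. \<mu> {}) \<longlonglongrightarrow> 0" by (intro summable_LIMSEQ_zero sums_summable)
  then show ?thesis by (simp add: LIMSEQ_const_iff)
qed

lemma vector_measure_Un:
  assumes "vector_measure X \<Sigma> \<mu>" "A \<in> \<Sigma>" "B \<in> \<Sigma>" "A \<inter> B = {}"
  shows "\<mu> (A \<union> B) = \<mu> A + \<mu> B"
proof -
  interpret sigma_algebra X \<Sigma> using assms by (simp add: vector_measure_def)
  have "disjoint_family (binaryset A B)"
    using assms(4) by (auto simp: disjoint_family_on_def binaryset_def)
  moreover have "range (binaryset A B) \<subseteq> \<Sigma>"
    using assms by (auto simp: range_binaryset_eq)
  ultimately have "(\<lambda>n. \<mu> (binaryset A B n)) sums \<mu> (A \<union> B)"
    using assms(1) unfolding vector_measure_def by (metis UN_binaryset_eq)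
  moreover have "(\<lambda>n. \<mu> (binaryset A B n)) sums (\<mu> A + \<mu> B)"
    using vector_measure_empty[OF assms(1)] by (rule binaryset_sums)
  ultimately show ?thesis by (rule sums_unique2)
qed

lemma vector_measure_finite_UN:
  assumes \<mu>: "vector_measure X \<Sigma> \<mu>" and "finite I"
    and "\<And>i. i \<in> I \<Longrightarrow> G i \<in> \<Sigma>" "disjoint_family_on G I"
  shows "\<mu> (\<Union>i\<in>I. G i) = (\<Sum>i\<in>I. \<mu> (G i))"
  using assms(2-)
proof (induction I rule: finite_induct)
  case empty
  then show ?case using vector_measure_empty[OF \<mu>] by simp
next
  case (insert i I)
  interpret sigma_algebra X \<Sigma> using \<mu> by (simp add: vector_measure_def)
  have "\<mu> (G i \<union> (\<Union>j\<in>I. G j)) = \<mu> (G i) + \<mu> (\<Union>j\<in>I. G j)"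
    using insert by (intro vector_measure_Un[OF \<mu>]) (auto simp: disjoint_family_on_def)
  moreover have "disjoint_family_on G I"
    using insert.prems(2) by (rule disjoint_family_on_mono[rotated]) auto
  ultimately show ?case using insert by simp
qed

lemma vector_measure_atoms:
  fixes \<mu> :: "'a set \<Rightarrow> 'v::euclidean_space"
  assumes \<mu>: "vector_measure X \<Sigma> \<mu>" and A: "A \<in> \<Sigma>"
    and E: "finite \<E>" "\<And>E. E \<in> \<E> \<Longrightarrow> E \<in> \<Sigma> \<and> E \<subseteq> A"
  obtains I :: "'a set set set" and G where "finite I" "disjoint_family_on G I"
    "\<And>i. i \<in> I \<Longrightarrow> G i \<in> \<Sigma> \<and> G i \<subseteq> A"
    "\<And>E. E \<in> \<E> \<Longrightarrow> \<exists>J\<subseteq>I. \<mu> E = (\<Sum>i\<in>J. \<mu> (G i))"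
proof -
  interpret sigma_algebra X \<Sigma> using \<mu> by (simp add: vector_measure_def)
  \<comment> \<open>The atom \<open>G T\<close> collects the points of \<open>A\<close> that lie in
    exactly the members \<open>T\<close> of \<open>\<E>\<close>. Empty atoms are kept: they are
    harmless to disjointness and sums, and the index set is simply \<open>Pow \<E>\<close>.\<close>
  define G where "G T = {x \<in> A. {E \<in> \<E>. x \<in> E} = T}" for T
  have disj: "disjoint_family_on G S" for S by (auto simp: disjoint_family_on_def G_def)
  have G: "G T \<in> \<Sigma> \<and> G T \<subseteq> A" if "T \<in> Pow \<E>" for T
  proof -
    define B where "B = {x \<in> X. \<forall>E\<in>\<E>. x \<in> (if E \<in> T then E else A - E)}"
    have "A \<subseteq> X" using A sets_into_space by blast
    then have "G T = A \<inter> B" using that by (auto simp: G_def B_def)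
    moreover have "B \<in> \<Sigma>"
      unfolding B_def
    proof (rule sets_Collect_finite_All[OF _ E(1)])
      fix E assume "E \<in> \<E>"
      with E have "E \<in> \<Sigma>" by blast
      with A have "(if E \<in> T then E else A - E) \<in> \<Sigma>" by auto
      moreover from this have "{x \<in> X. x \<in> (if E \<in> T then E else A - E)} = (if E \<in> T then E else A - E)"
        using sets_into_space by blast
      ultimately show "{x \<in> X. x \<in> (if E \<in> T then E else A - E)} \<in> \<Sigma>" by simp
    qed
    ultimately show ?thesis using A by auto
  qed
  have "\<exists>J\<subseteq>Pow \<E>. \<mu> E = (\<Sum>i\<in>J. \<mu> (G i))" if "E \<in> \<E>" for E
  proof -
    define J where "J = {T \<in> Pow \<E>. E \<in> T}"
    have "x \<in> (\<Union>T\<in>J. G T)" if "x \<in> E" for x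
    proof (rule UN_I)
      show "{F \<in> \<E>. x \<in> F} \<in> J" using that \<open>E \<in> \<E>\<close> by (simp add: J_def)
      show "x \<in> G {F \<in> \<E>. x \<in> F}" using that E(2)[OF \<open>E \<in> \<E>\<close>] by (auto simp: G_def)
    qed
    moreover have "G T \<subseteq> E" if "T \<in> J" for T using that by (auto simp: G_def J_def)
    ultimately have "(\<Union>T\<in>J. G T) = E" by blast
    moreover have "finite J" using E(1) by (simp add: J_def)
    then have "\<mu> (\<Union>T\<in>J. G T) = (\<Sum>T\<in>J. \<mu> (G T))"
      using G by (intro vector_measure_finite_UN[OF \<mu>] disj) (auto simp: J_def)
    ultimately have "\<mu> E = (\<Sum>T\<in>J. \<mu> (G T))" by simp
    moreover have "J \<subseteq> Pow \<E>" by (auto simp: J_def)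
    ultimately show ?thesis by blast
  qed
  moreover have "finite (Pow \<E>)" using E(1) by simp
  ultimately show thesis using that[of "Pow \<E>" G] G disj by blast
qed

lemma total_variation_ge_sum:
  assumes "finite I" "disjoint_family_on G I" "\<And>i. i \<in> I \<Longrightarrow> G i \<in> \<Sigma> \<and> G i \<subseteq> A"
  shows "ereal (\<Sum>i\<in>I. N (\<mu> (G i))) \<le> total_variation N \<Sigma> \<mu> A"
proof -
  obtain h where h: "bij_betw h {..<card I} I"
    using ex_bij_betw_nat_finite[OF assms(1)] by (auto simp: atLeast0LessThan)
  have mem: "h k \<in> I" if "k < card I" for k
    using h that by (auto simp: bij_betw_def)
  have inj: "inj_on h {..<card I}" using h by (auto simp: bij_betw_def)
  have "disjoint_family_on (\<lambda>k. G (h k)) {..<card I}"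
    unfolding disjoint_family_on_def
  proof (intro ballI impI)
    fix j k assume "j \<in> {..<card I}" "k \<in> {..<card I}" "j \<noteq> k"
    moreover from this have "h j \<noteq> h k" using inj by (auto dest: inj_onD)
    ultimately show "G (h j) \<inter> G (h k) = {}"
      using assms(2) mem by (auto simp: disjoint_family_on_def)
  qed
  then have "ereal (\<Sum>k<card I. N (\<mu> (G (h k)))) \<le> total_variation N \<Sigma> \<mu> A"
    unfolding total_variation_def
    using assms(3) mem by (intro SUP_upper2[of "(\<lambda>k. G (h k), card I)"]) auto
  then show ?thesis using sum.reindex_bij_betw[OF h, of "\<lambda>i. N (\<mu> (G i))"] by simp
qed

section \<open>Vertices and edges of plane polygons\<close>

lemma convex_hull_le_inner:
  assumes "\<And>s. s \<in> S \<Longrightarrow> u \<bullet> s \<le> B" "x \<in> convex hull S"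
  shows "u \<bullet> x \<le> B"
proof -
  have "convex hull S \<subseteq> {x. u \<bullet> x \<le> B}"
    using assms(1) by (intro hull_minimal convex_halfspace_le) auto
  then show ?thesis using assms(2) by blast
qed

lemma polygon_eq_hull_vertices:
  fixes P :: "'v::euclidean_space set"
  assumes "convex_polygon P"
  shows "P = convex hull {v. v extreme_point_of P}"
proof -
  obtain S where "finite S" "P = convex hull S" using assms by (auto simp: convex_polygon_def)
  then show ?thesis using Krein_Milman_Minkowski[of P] by (simp add: finite_imp_compact_convex_hull)
qed

text \<open>The second form is the simplifier's normal form of the left-hand side of the first.\<close>

lemma pred_mod_eq:
  fixes i n :: nat
  assumes "i < n"
  shows "(i + n - 1) mod n = (if i = 0 then n - 1 else i - 1)"
    and "(i + n - Suc 0) mod n = (if i = 0 then n - 1 else i - 1)"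
proof -
  show "(i + n - 1) mod n = (if i = 0 then n - 1 else i - 1)"
  proof (cases "i = 0")
    case False
    have "(i + n - 1) mod n = (i - 1 + n) mod n" using False by simp
    also have "\<dots> = i - 1" using assms False by (simp only: mod_add_self2) simp
    finally show ?thesis using False by simp
  qed (use assms in simp)
  then show "(i + n - Suc 0) mod n = (if i = 0 then n - 1 else i - 1)" by simp
qed

lemma distinct_sorting_by_key:
  fixes f :: "'a \<Rightarrow> real"
  assumes "finite S" "inj_on f S"
  obtains xs where "set xs = S" "distinct xs"
    "\<And>i j. i < j \<Longrightarrow> j < length xs \<Longrightarrow> f (xs ! i) < f (xs ! j)"
proof -
  obtain ys where ys: "set ys = S" "distinct ys" using finite_distinct_list[OF assms(1)] by blast
  define xs where "xs = sort_key f ys"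
  have xs: "set xs = S" "distinct xs" "sorted (map f xs)" using ys by (simp_all add: xs_def)
  have "f (xs ! i) < f (xs ! j)" if "i < j" "j < length xs" for i j
  proof -
    have "f (xs ! i) \<le> f (xs ! j)" using xs(3) that by (auto simp: sorted_iff_nth_mono)
    moreover have "xs ! i \<noteq> xs ! j" using xs(2) that by (auto simp: nth_eq_iff_index_eq)
    then have "f (xs ! i) \<noteq> f (xs ! j)"
      using assms(2) xs(1) that by (metis inj_onD nth_mem less_trans)
    ultimately show ?thesis by simp
  qed
  with xs show thesis by (intro that) auto
qed

text \<open>The functional \<open>g\<close> separates the line through \<open>x\<close> and
  \<open>y\<close> from the hull of the other points. The case \<open>x = y\<close> is allowed and
  covers the polygon with a single vertex.\<close>

lemma edge_face_of_convex_hull: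
  assumes "finite V" "x \<in> V" "y \<in> V" "g \<bullet> x = g \<bullet> y"
    and "\<And>w. w \<in> V - {x, y} \<Longrightarrow> g \<bullet> x < g \<bullet> w"
  shows "closed_segment x y face_of convex hull V"
proof -
  have "affine hull {x, y} \<subseteq> {z. g \<bullet> z = g \<bullet> x}"
    using assms(4) by (intro hull_minimal affine_hyperplane) auto
  moreover have "convex hull (V - {x, y}) \<subseteq> {z. g \<bullet> x < g \<bullet> z}"
    using assms(5) by (intro hull_minimal convex_halfspace_gt) auto
  ultimately have "affine hull {x, y} \<inter> convex hull (V - {x, y}) = {}" by fastforce
  then show ?thesis
    using face_of_convex_hulls[of V "{x, y}"] assms by (simp add: segment_convex_hull)
qed

text \<open>The vertices are listed by the slope at which they are seen from the vertex \<open>a\<close> of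
  largest norm. Each vertex lies beyond the chord of \<open>a\<close> and any two vertices surrounding it,
  so every triple of vertices in list order is positively oriented.\<close>

lemma cyclic_vertex_list_exists:
  fixes P :: "'v::euclidean_space set"
  assumes dim: "DIM('v) = 2" and P: "convex_polygon P"
  shows "\<exists>vs. cyclic_vertex_list P vs"
proof -
  obtain e f :: 'v where ef: "Basis = {e, f}" "e \<noteq> f"
    using dim by (auto simp: card_2_iff)
  have ort: "e \<bullet> e = 1" "f \<bullet> f = 1" "e \<bullet> f = 0" "f \<bullet> e = 0"
    using ef by (auto intro!: inner_same_Basis inner_not_same_Basis)
  have eqI: "x = y" if "x \<bullet> e = y \<bullet> e" "x \<bullet> f = y \<bullet> f" for x y
    by (rule euclidean_eqI) (use that ef in auto)
  define V where "V = {v. v extreme_point_of P}"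
  obtain S where S: "finite S" "P = convex hull S" using P by (auto simp: convex_polygon_def)
  have "V \<subseteq> S" using S extreme_point_of_convex_hull by (auto simp: V_def)
  then have fin: "finite V" using S(1) by (rule finite_subset)
  have P_eq: "P = convex hull V" unfolding V_def using P by (rule polygon_eq_hull_vertices)
  have indep: "v \<notin> convex hull T" if "v \<in> V" "T \<subseteq> V - {v}" for v T
  proof -
    have "convex (P - {v})" "V \<subseteq> P" "v \<in> P"
      using that(1) extreme_point_of_stillconvex[of P v] S(2)
      by (auto simp: V_def extreme_point_of_def)
    then have "convex hull T \<subseteq> P - {v}" using that(2) by (intro hull_minimal) auto
    then show ?thesis by blast
  qed
  show ?thesis
  proof (cases "V = {}")
    case True
    then show ?thesis by (intro exI[of _ "[]"]) (simp add: cyclic_vertex_list_def V_def)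
  next
    case False
    obtain a where a: "a \<in> V" "\<And>w. w \<in> V \<Longrightarrow> norm w \<le> norm a"
    proof -
      have "Max (norm ` V) \<in> norm ` V" using fin False by simp
      moreover have "norm w \<le> Max (norm ` V)" if "w \<in> V" for w using fin that by simp
      ultimately show thesis using that by (metis imageE)
    qed
    \<comment> \<open>\<open>b\<close> is \<open>a\<close> turned by a right angle, so
      \<open>p\<close> and \<open>q\<close> are scaled orthogonal coordinates with origin
      \<open>a\<close>, and \<open>D\<close> is twice the signed area of a triangle in them. As
      \<open>a\<close> has largest norm, all other vertices have \<open>p > 0\<close>, so the slope
      \<open>q / p\<close> is defined.\<close>
    define b where "b = (a \<bullet> e) *\<^sub>R f - (a \<bullet> f) *\<^sub>R e"
    define p q where "p x = a \<bullet> (a - x)" and "q x = b \<bullet> (x - a)" for x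
    define D where "D x y z = (p y - p x) * (q z - q x) - (q y - q x) * (p z - p x)" for x y z
    have p_pos: "0 < p w" if "w \<in> V - {a}" for w
    proof -
      have "0 < (norm (a - w))\<^sup>2" using that by auto
      also have "\<dots> = (norm a)\<^sup>2 + (norm w)\<^sup>2 - 2 * (a \<bullet> w)"
        by (simp add: power2_norm_eq_inner inner_diff inner_commute algebra_simps)
      also have "\<dots> \<le> 2 * (norm a)\<^sup>2 - 2 * (a \<bullet> w)"
        using a(2)[of w] that by (simp add: power_mono)
      finally show ?thesis by (simp add: p_def inner_diff_right power2_norm_eq_inner)
    qed
    have pq0: "p a = 0" "q a = 0" by (simp_all add: p_def q_def)
    have pq_inj: "x = y" if "p x = p y" "q x = q y" "a \<noteq> 0" for x y
    proof -
      have inner_eq: "v \<bullet> w = (v \<bullet> e) * (w \<bullet> e) + (v \<bullet> f) * (w \<bullet> f)" for v w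
      proof -
        have "(\<Sum>b\<in>{e, f}. (v \<bullet> b) * (w \<bullet> b)) = v \<bullet> w"
          unfolding ef(1)[symmetric] by (rule euclidean_inner[symmetric])
        then show ?thesis using ef(2) by simp
      qed
      define m n where "m = (x - y) \<bullet> e" and "n = (x - y) \<bullet> f"
      have "a \<bullet> (x - y) = 0" "b \<bullet> (x - y) = 0"
        using that by (simp_all add: p_def q_def inner_diff_right)
      then have 1: "(a \<bullet> e) * m + (a \<bullet> f) * n = 0" "(a \<bullet> e) * n - (a \<bullet> f) * m = 0"
        unfolding inner_eq[of a "x - y"] inner_eq[of b "x - y"]
        by (simp_all add: b_def m_def n_def inner_diff_left ort)
      have "((a \<bullet> e)\<^sup>2 + (a \<bullet> f)\<^sup>2) * m = 0" "((a \<bullet> e)\<^sup>2 + (a \<bullet> f)\<^sup>2) * n = 0"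
        using 1 by algebra+
      moreover have "(a \<bullet> e)\<^sup>2 + (a \<bullet> f)\<^sup>2 \<noteq> 0"
        using that(3) eqI[of a 0] by (auto simp: sum_power2_eq_zero_iff)
      ultimately have "m = 0" "n = 0" by (metis mult_eq_0_iff)+
      then show ?thesis using eqI[of x y] by (simp add: m_def n_def inner_diff_left)
    qed
    \<comment> \<open>With \<open>a\<close> as origin, coefficients of sum at most 1 describe the
      triangle \<open>a\<close>, \<open>y\<close>, \<open>z\<close>, which cannot contain another
      vertex \<open>x\<close>.\<close>
    have no_combination: False
      if "x \<in> V - {a}" "y \<in> V - {x}" "z \<in> V - {x}" "p x = s * p y + t * p z" "q x = s * q y + t * q z"
        "0 \<le> s" "0 \<le> t" "s + t \<le> 1" for x y z s t
    proof -
      define w where "w = (1 - s - t) *\<^sub>R a + s *\<^sub>R y + t *\<^sub>R z"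
      have "p w = s * p y + t * p z" "q w = s * q y + t * q z"
        by (simp_all add: w_def p_def q_def algebra_simps)
      moreover have "a \<noteq> 0" using p_pos[OF that(1)] by (auto simp: p_def)
      ultimately have "x = w" using pq_inj that by simp
      moreover have "w \<in> convex hull {a, y, z}"
        unfolding convex_hull_3 w_def using that
        by (intro CollectI exI[of _ "1 - s - t"] exI[of _ s] exI[of _ t]) auto
      ultimately show False using indep[of x "{a, y, z}"] that a(1) by auto
    qed
    define key where "key w = q w / p w" for w
    have q_key: "q w = key w * p w" if "w \<in> V - {a}" for w
      using p_pos[OF that] by (simp add: key_def)
    have D_a: "D a y z = p y * p z * (key z - key y)" if "y \<in> V - {a}" "z \<in> V - {a}" for y z
      using q_key that by (simp add: D_def pq0 algebra_simps)
    have D_a_pos: "0 < D a y z" if "y \<in> V - {a}" "z \<in> V - {a}" "key y < key z" for y z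
      using D_a[OF that(1,2)] p_pos that by simp
    have le_of_key_eq: "x = y" if "x \<in> V - {a}" "y \<in> V - {a}" "key x = key y" "p x \<le> p y" for x y
    proof (rule ccontr)
      assume "x \<noteq> y"
      then show False
        using no_combination[of x y y "p x / p y" 0] that p_pos[of x] p_pos[of y] q_key[of x] q_key[of y]
        by auto
    qed
    have key_inj: "inj_on key (V - {a})"
      by (rule inj_onI) (metis le_of_key_eq linear)
    have D_pos: "0 < D x y z"
      if "x \<in> V - {a}" "y \<in> V - {a}" "z \<in> V - {a}" "key x < key y" "key y < key z" for x y z
    proof (rule ccontr)
      assume neg: "\<not> 0 < D x y z"
      \<comment> \<open>Cramer's rule expresses \<open>y\<close> through \<open>x\<close> and
        \<open>z\<close>. The identity \<open>D a x y + D a y z = D a x z + D x y z\<close> turns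
        the negated claim into a bound of 1 on the sum of the coefficients.\<close>
      define d where "d = D a x z"
      have pos: "0 < D a x y" "0 < D a y z" "0 < d" using D_a_pos that by (simp_all add: d_def)
      have "p y * d = D a y z * p x + D a x y * p z" "q y * d = D a y z * q x + D a x y * q z"
        by (simp_all add: d_def D_def pq0 algebra_simps)
      then have "p y = D a y z / d * p x + D a x y / d * p z" "q y = D a y z / d * q x + D a x y / d * q z"
        using pos(3) by (simp_all add: field_simps)
      moreover have "D a y z + D a x y \<le> d"
        using neg by (simp add: d_def D_def pq0 algebra_simps)
      then have "D a y z / d + D a x y / d \<le> 1"
        using pos(3) by (simp add: add_divide_distrib[symmetric])
      ultimately show False
        using no_combination[of y x z "D a y z / d" "D a x y / d"] that pos by auto
    qed
    obtain bs where bs: "set bs = V - {a}" "distinct bs"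
      and sorted: "\<And>i j. i < j \<Longrightarrow> j < length bs \<Longrightarrow> key (bs ! i) < key (bs ! j)"
      using distinct_sorting_by_key[OF _ key_inj] fin by auto
    define vs where "vs = a # bs"
    have vs: "distinct vs" "set vs = V" using bs a(1) by (auto simp: vs_def)
    have triple: "0 < D (vs ! i) (vs ! j) (vs ! k)" if "i < j" "j < k" "k < length vs" for i j k
    proof -
      have b_mem: "vs ! l = bs ! (l - 1)" "bs ! (l - 1) \<in> V - {a}" if "0 < l" "l < length vs" for l
        using that bs(1) nth_mem[of "l - 1" bs] by (auto simp: vs_def nth_Cons')
      have jk: "key (vs ! j) < key (vs ! k)"
        using sorted[of "j - 1" "k - 1"] that b_mem(1)[of j] b_mem(1)[of k] by (auto simp: vs_def)
      show ?thesis
      proof (cases "i = 0")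
        case True
        then show ?thesis using D_a_pos[of "vs ! j" "vs ! k"] jk b_mem[of j] b_mem[of k] that
          by (simp add: vs_def)
      next
        case False
        then have "key (vs ! i) < key (vs ! j)"
          using sorted[of "i - 1" "j - 1"] that b_mem(1)[of i] b_mem(1)[of j] by (auto simp: vs_def)
        then show ?thesis using D_pos[of "vs ! i" "vs ! j" "vs ! k"] jk False that
            b_mem[of i] b_mem[of j] b_mem[of k] by simp
      qed
    qed
    have cyc: "D x y z = D y z x" "D x y z = D z x y" for x y z by (simp_all add: D_def algebra_simps)
    have "closed_segment (vs ! ((i + length vs - 1) mod length vs)) (vs ! i) face_of P"
      if "i < length vs" for i
    proof -
      define n where "n = length vs"
      define j where "j = (if i = 0 then n - 1 else i - 1)"
      define x y where "x = vs ! j" and "y = vs ! i"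
      have jn: "j < n" "i < n" using that by (auto simp: n_def j_def)
      have xy: "x \<in> V" "y \<in> V" using jn vs(2) by (auto simp: x_def y_def n_def)
      have pos: "0 < D x y w" if "w \<in> V - {x, y}" for w
      proof -
        obtain k where k: "k < n" "w = vs ! k" using \<open>w \<in> V - {x, y}\<close> vs(2) by (auto simp: in_set_conv_nth n_def)
        then have "k \<noteq> i" "k \<noteq> j" using \<open>w \<in> V - {x, y}\<close> by (auto simp: x_def y_def)
        \<comment> \<open>A cyclic rotation of \<open>j\<close>, \<open>i\<close>, \<open>k\<close>
          puts the indices in increasing order; \<open>i = 0\<close> is the edge closing the list.
          With at most two vertices there is no such \<open>k\<close>.\<close>
        then consider "i = 0" "0 < k" "k < j" | "0 < i" "k < j" "j < i" | "0 < i" "j < i" "i < k"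
          using jn k(1) by (cases "i = 0"; cases "k < j") (auto simp: j_def)
        then show ?thesis
        proof cases
          case 1 then show ?thesis using triple[of 0 k j] cyc(2)[of x y w] cyc(1)[of x y w] jn k by (simp add: x_def y_def n_def)
        next
          case 2 then show ?thesis using triple[of k j i] cyc(2)[of x y w] jn k by (simp add: x_def y_def n_def)
        next
          case 3 then show ?thesis using triple[of j i k] jn k by (simp add: x_def y_def n_def)
        qed
      qed
      \<comment> \<open>\<open>g\<close> is the gradient of the affine map \<open>D x y\<close>, so
        positive orientation of all triples makes it a supporting functional along this
        edge.\<close>
      define g where "g = (p y - p x) *\<^sub>R b + (q y - q x) *\<^sub>R a"
      have D_g: "D x y w = g \<bullet> w - g \<bullet> x" for w
        by (simp add: D_def g_def p_def q_def inner_add_left inner_diff_right algebra_simps)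
      have "D x y y = 0" by (simp add: D_def)
      then have "closed_segment x y face_of convex hull V"
        using fin xy pos D_g by (intro edge_face_of_convex_hull[of _ _ _ g]) auto
      then show ?thesis by (simp only: pred_mod_eq[OF that] P_eq x_def y_def j_def n_def)
    qed
    then show ?thesis using vs by (intro exI[of _ vs]) (simp add: cyclic_vertex_list_def V_def)
  qed
qed

text \<open>A common point would, by the face property of edge \<open>j\<close>, pull both ends of
  edge \<open>i\<close> onto edge \<open>j\<close>; being extreme points, they would be its ends.
  Three vertices are required because with two both edges are the same segment.\<close>

lemma cyclic_edges_disjoint:
  assumes vs: "cyclic_vertex_list P vs"
    and n: "3 \<le> length vs" and i: "i < length vs" and j: "j < length vs" and "i \<noteq> j"
    and "p \<in> open_segment (vs ! ((i + length vs - 1) mod length vs)) (vs ! i)"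
  shows "p \<notin> closed_segment (vs ! ((j + length vs - 1) mod length vs)) (vs ! j)"
proof
  let ?n = "length vs"
  define prev where "prev k = (if k = 0 then ?n - 1 else k - 1)" for k
  assume p: "p \<in> closed_segment (vs ! ((j + ?n - 1) mod ?n)) (vs ! j)"
  have prev_less: "prev k < ?n" if "k < ?n" for k using that by (auto simp: prev_def)
  have ext: "vs ! k extreme_point_of P" if "k < ?n" for k
    using vs nth_mem[OF that] by (auto simp: cyclic_vertex_list_def)
  then have mem: "vs ! k \<in> P" if "k < ?n" for k
    using that by (auto simp: extreme_point_of_def)
  have "closed_segment (vs ! prev j) (vs ! j) face_of P"
    using vs j by (simp add: cyclic_vertex_list_def pred_mod_eq prev_def)
  then have "vs ! prev i \<in> closed_segment (vs ! prev j) (vs ! j) \<and> vs ! i \<in> closed_segment (vs ! prev j) (vs ! j)"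
    using face_ofD[of _ P p "vs ! prev i" "vs ! i"] assms(6) p i j mem prev_less
    by (simp add: pred_mod_eq prev_def)
  then have "vs ! k = vs ! prev j \<or> vs ! k = vs ! j" if "k \<in> {prev i, i}" for k
    using that ext[of k] mem[of j] mem[of "prev j"] prev_less i j
    by (auto simp: extreme_point_of_def open_segment_def)
  then have "k = prev j \<or> k = j" if "k \<in> {prev i, i}" for k
    using that vs i j prev_less by (fastforce simp: cyclic_vertex_list_def nth_eq_iff_index_eq)
  from this[of i] this[of "prev i"] show False
    using \<open>i \<noteq> j\<close> n i j by (auto simp: prev_def split: if_splits)
qed

text \<open>Of three collinear points on different edges the middle one would force, by the face
  property of its edge, the other two onto that edge.\<close>

lemma card_crossed_edges_le_2:
  fixes u :: "'v::euclidean_space"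
  assumes dim: "DIM('v) = 2" and vs: "cyclic_vertex_list P vs"
  defines "prev \<equiv> \<lambda>i. vs ! ((i + length vs - 1) mod length vs)"
  shows "card {i. i < length vs \<and> min (u \<bullet> prev i) (u \<bullet> vs ! i) < t \<and> t < max (u \<bullet> prev i) (u \<bullet> vs ! i)} \<le> 2"
    (is "card ?I \<le> 2")
proof (rule ccontr)
  let ?n = "length vs"
  assume "\<not> card ?I \<le> 2"
  then have three: "3 \<le> card ?I" by simp
  then obtain T where "T \<subseteq> ?I" "card T = 3" by (meson obtain_subset_with_card_n)
  then obtain i j k where ijk: "i \<in> ?I" "j \<in> ?I" "k \<in> ?I" "i \<noteq> j" "j \<noteq> k" "k \<noteq> i"
    by (auto simp: card_3_iff)
  have "card ?I \<le> card {..<?n}" by (rule card_mono) auto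
  then have n: "3 \<le> ?n" using three by simp
  have crossing: "\<exists>p \<in> open_segment (prev l) (vs ! l). u \<bullet> p = t" if "l \<in> ?I" for l
  proof -
    define x y where "x = prev l" and "y = vs ! l"
    have ne: "u \<bullet> x \<noteq> u \<bullet> y" using that by (auto simp: x_def y_def)
    define r where "r = (t - u \<bullet> x) / (u \<bullet> y - u \<bullet> x)"
    have "min (u \<bullet> x) (u \<bullet> y) < t \<and> t < max (u \<bullet> x) (u \<bullet> y)" using that by (simp add: x_def y_def)
    then have r: "0 < r" "r < 1" using ne
      by (auto simp: r_def divide_simps min_def max_def split: if_splits)
    have "u \<bullet> ((1 - r) *\<^sub>R x + r *\<^sub>R y) = u \<bullet> x + r * (u \<bullet> y - u \<bullet> x)"
      by (simp add: inner_add_right algebra_simps)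
    also have "\<dots> = t" using ne by (simp add: r_def)
    finally show ?thesis unfolding x_def[symmetric] y_def[symmetric]
      using r ne by (intro bexI[of _ "(1 - r) *\<^sub>R x + r *\<^sub>R y"]) (auto simp: in_segment)
  qed
  then have "\<forall>l\<in>?I. \<exists>p. p \<in> open_segment (prev l) (vs ! l) \<and> u \<bullet> p = t" by blast
  from bchoice[OF this] obtain p where
    "\<forall>l\<in>?I. p l \<in> open_segment (prev l) (vs ! l) \<and> u \<bullet> p l = t" by blast
  then have p: "p l \<in> open_segment (prev l) (vs ! l) \<and> u \<bullet> p l = t" if "l \<in> ?I" for l
    using that by blast
  have not_between: False
    if "a \<in> ?I" "b \<in> ?I" "c \<in> ?I" "a \<noteq> b" "b \<noteq> c" "p b \<in> closed_segment (p a) (p c)" for a b c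
  proof -
    have face: "closed_segment (prev l) (vs ! l) face_of P" if "l \<in> ?I" for l
      using vs that by (auto simp: cyclic_vertex_list_def prev_def)
    have edge: "p l \<in> closed_segment (prev l) (vs ! l)" if "l \<in> ?I" for l
      using p[OF that] by (auto simp: open_segment_def)
    have off_edge: "p a \<notin> closed_segment (prev b) (vs ! b)"
      "p c \<notin> closed_segment (prev b) (vs ! b)"
      using cyclic_edges_disjoint[OF vs n, of _ b] p that by (auto simp: prev_def)
    then have "p b \<in> open_segment (p a) (p c)"
      using that(6) edge[OF that(2)] by (auto simp: open_segment_def)
    moreover have "p a \<in> P" "p c \<in> P" using edge face that face_of_imp_subset by blast+
    ultimately show False
      using face_ofD[OF face[OF that(2)]] edge[OF that(2)] off_edge by blast
  qed
  \<comment> \<open>In the plane the level set of a nonzero \<open>u\<close> is a line, so one of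
    the three crossing points lies between the other two.\<close>
  have "u \<noteq> 0" using ijk(1) by auto
  then have "aff_dim {x. u \<bullet> x = t} = 1" using dim by simp
  moreover have "{p i, p j, p k} \<subseteq> {x. u \<bullet> x = t}" using p ijk by auto
  ultimately have "collinear {p i, p j, p k}"
    by (metis aff_dim_subset collinear_aff_dim)
  then consider "p i \<in> closed_segment (p j) (p k)" | "p j \<in> closed_segment (p k) (p i)"
    | "p k \<in> closed_segment (p i) (p j)"
    by (auto simp: collinear_between_cases between_mem_segment)
  then show False
  proof cases
    case 1 then show ?thesis using not_between[of j i k] ijk by blast
  next
    case 2 then show ?thesis using not_between[of k j i] ijk by blast
  next
    case 3 then show ?thesis using not_between[of i k j] ijk by blast
  qed
qed

section \<open>Projected length of the boundary and width\<close>

text \<open>The projected length of an edge becomes the measure of the levels that it crosses, so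
  that the sum over edges can be exchanged with the integral over levels. The open interval matches
  the strict crossings counted before; levels through vertices need no exception.\<close>

lemma abs_diff_eq_interval_integral:
  "\<bar>x - y\<bar> = (LINT t|lborel. indicator {min x y<..<max x y} t)" for x y :: real
proof -
  have "(LINT t|lborel. indicator {min x y<..<max x y} t) = measure lborel {min x y<..<max x y}"
    by simp
  also have "\<dots> = max x y - min x y" by (intro measure_lborel_Ioo) simp
  also have "\<dots> = \<bar>x - y\<bar>" by simp
  finally show ?thesis by (rule sym)
qed

lemma edge_projections_le:
  fixes u :: "'v::euclidean_space"
  assumes dim: "DIM('v) = 2" and vs: "cyclic_vertex_list P vs"
    and width: "\<And>x y. x \<in> P \<Longrightarrow> y \<in> P \<Longrightarrow> u \<bullet> (y - x) \<le> B" and "P \<noteq> {}"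
  shows "(\<Sum>i<length vs. \<bar>u \<bullet> (vs ! i - vs ! ((i + length vs - 1) mod length vs))\<bar>) \<le> 2 * B"
proof (cases "vs = []")
  case True
  then show ?thesis using width \<open>P \<noteq> {}\<close> by fastforce
next
  case False
  let ?n = "length vs"
  define prev where "prev i = vs ! ((i + ?n - 1) mod ?n)" for i
  define J where "J i = {min (u \<bullet> prev i) (u \<bullet> vs ! i)<..<max (u \<bullet> prev i) (u \<bullet> vs ! i)}" for i
  define m M where "m = Min ((\<bullet>) u ` set vs)" and "M = Max ((\<bullet>) u ` set vs)"
  have range: "m \<le> u \<bullet> v \<and> u \<bullet> v \<le> M" if "v \<in> set vs" for v
    using that by (simp add: m_def M_def)
  have "m \<in> (\<bullet>) u ` set vs" "M \<in> (\<bullet>) u ` set vs"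
    unfolding m_def M_def using False by (intro Min_in Max_in; simp)+
  then obtain x y where xy: "x \<in> set vs" "y \<in> set vs" "u \<bullet> x = m" "u \<bullet> y = M" by auto
  have "set vs \<subseteq> P" using vs by (auto simp: cyclic_vertex_list_def extreme_point_of_def)
  then have "M - m \<le> B" using width[of x y] xy by (auto simp: inner_diff_right)
  have "m \<le> M" using range[OF xy(1)] by simp
  have "prev i \<in> set vs" if "i < ?n" for i using that by (auto simp: prev_def pred_mod_eq)
  then have J_sub: "J i \<subseteq> {m..M}" if "i < ?n" for i
    using range[of "prev i"] range[of "vs ! i"] that by (auto simp: J_def)
  have J_int: "integrable lborel (indicator (J i) :: real \<Rightarrow> real)" for i
    by (simp add: J_def min_def max_def)
  have "(\<Sum>i<?n. \<bar>u \<bullet> (vs ! i - prev i)\<bar>) = (\<Sum>i<?n. LINT t|lborel. indicator (J i) t)"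
    unfolding J_def abs_diff_eq_interval_integral[symmetric]
    by (simp add: inner_diff_right abs_minus_commute)
  also have "\<dots> = (LINT t|lborel. (\<Sum>i<?n. indicator (J i) t))"
    using J_int by (intro Bochner_Integration.integral_sum[symmetric]) auto
  also have "\<dots> \<le> (LINT t|lborel. 2 * indicator {m..M} t)"
  proof (rule integral_mono)
    fix t
    have "(\<Sum>i<?n. indicator (J i) t) = real (card {i. i < ?n \<and> t \<in> J i})"
      by (simp add: indicator_def sum.If_cases Int_def)
    also have "\<dots> \<le> 2 * indicator {m..M} t"
    proof (cases "t \<in> {m..M}")
      case True
      then show ?thesis
        using card_crossed_edges_le_2[OF dim vs, of u t] by (simp add: J_def prev_def)
    next
      case False
      then have "{i. i < ?n \<and> t \<in> J i} = {}" using J_sub by blast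
      then show ?thesis by (simp only: card.empty) simp
    qed
    finally show "(\<Sum>i<?n. indicator (J i) t) \<le> 2 * (indicator {m..M} t :: real)" .
  next
    show "integrable lborel (\<lambda>t. \<Sum>i<?n. indicator (J i) t :: real)" using J_int by auto
    show "integrable lborel (\<lambda>t. 2 * indicator {m..M} t :: real)"
      by (intro integrable_mult_right integrable_real_indicator) (auto simp: emeasure_lborel_Icc_eq)
  qed
  also have "\<dots> = 2 * (M - m)" using \<open>m \<le> M\<close> by simp
  finally show ?thesis using \<open>M - m \<le> B\<close> by (simp add: prev_def)
qed

lemma abs_telescope_le:
  fixes h :: "nat \<Rightarrow> real"
  assumes "i \<le> j"
  shows "\<bar>h j - h i\<bar> \<le> (\<Sum>k\<in>{i<..j}. \<bar>h k - h (k - 1)\<bar>)"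
  using assms
proof (induction rule: dec_induct)
  case (step j)
  have "{i<..Suc j} = insert (Suc j) {i<..j}" using step.hyps by auto
  then show ?case using step.IH by simp
qed simp

text \<open>A closed walk visiting \<open>h i\<close> and \<open>h j\<close> covers their distance
  twice: once between the two indices and once on the way around, which includes the closing step at
  \<open>k = 0\<close>.\<close>

lemma closed_walk_length_ge:
  fixes h :: "nat \<Rightarrow> real"
  assumes "i < n" "j < n"
  shows "2 * (h j - h i) \<le> (\<Sum>k<n. \<bar>h k - h ((k + n - 1) mod n)\<bar>)"
proof -
  have *: "2 * \<bar>h j - h i\<bar> \<le> (\<Sum>k<n. \<bar>h k - h ((k + n - 1) mod n)\<bar>)" if "i \<le> j" "j < n" for i j
  proof -
    let ?f = "\<lambda>k. \<bar>h k - h (k - 1)\<bar>"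
    let ?g = "\<lambda>k. \<bar>h k - h (if k = 0 then n - 1 else k - 1)\<bar>"
    have split: "{..<n} = insert 0 ({0<..i} \<union> ({i<..j} \<union> {j<..n - 1}))" using that by auto
    have "(\<Sum>k<n. \<bar>h k - h ((k + n - 1) mod n)\<bar>) = sum ?g {..<n}"
      by (intro sum.cong) (simp_all only: pred_mod_eq lessThan_iff)
    also have "\<dots> = \<bar>h 0 - h (n - 1)\<bar> + sum ?g ({0<..i} \<union> ({i<..j} \<union> {j<..n - 1}))"
      unfolding split by (subst sum.insert) auto
    also have "sum ?g ({0<..i} \<union> ({i<..j} \<union> {j<..n - 1})) = sum ?f ({0<..i} \<union> ({i<..j} \<union> {j<..n - 1}))"
      by (intro sum.cong) auto
    also have "\<dots> = sum ?f {0<..i} + (sum ?f {i<..j} + sum ?f {j<..n - 1})"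
      using that by (subst sum.union_disjoint; (subst sum.union_disjoint)?) auto
    finally have "(\<Sum>k<n. \<bar>h k - h ((k + n - 1) mod n)\<bar>) = \<bar>h 0 - h (n - 1)\<bar> +
        (sum ?f {0<..i} + (sum ?f {i<..j} + sum ?f {j<..n - 1}))" .
    moreover have "\<bar>h i - h 0\<bar> \<le> sum ?f {0<..i}" "\<bar>h j - h i\<bar> \<le> sum ?f {i<..j}"
      "\<bar>h (n - 1) - h j\<bar> \<le> sum ?f {j<..n - 1}"
      using that by (intro abs_telescope_le; simp)+
    moreover have "\<bar>h j - h i\<bar> \<le> \<bar>h 0 - h (n - 1)\<bar> + \<bar>h i - h 0\<bar> + \<bar>h (n - 1) - h j\<bar>"
      by linarith
    ultimately show ?thesis
      by (smt (verit))
  qed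
  show ?thesis
  proof (cases "i \<le> j")
    case True
    then show ?thesis using *[OF _ assms(2)] abs_ge_self[of "h j - h i"] by fastforce
  next
    case False
    then show ?thesis using *[OF _ assms(1), of j] abs_ge_minus_self[of "h i - h j"] by fastforce
  qed
qed

text \<open>The walk along the boundary gives the bound for pairs of vertices. It extends to
  \<open>y\<close> and then to \<open>x\<close>, because a linear bound on the vertices holds on
  their hull.\<close>

lemma edge_projections_ge:
  assumes P: "convex_polygon P" and vs: "cyclic_vertex_list P vs" and xy: "x \<in> P" "y \<in> P"
  shows "2 * (u \<bullet> (y - x)) \<le> (\<Sum>i<length vs. \<bar>u \<bullet> (vs ! i - vs ! ((i + length vs - 1) mod length vs))\<bar>)"
    (is "_ \<le> ?S")
proof -
  have P_eq: "P = convex hull set vs"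
    using polygon_eq_hull_vertices[OF P] vs by (simp add: cyclic_vertex_list_def)
  have vertices: "u \<bullet> w \<le> u \<bullet> v + ?S / 2" if v: "v \<in> set vs" and w: "w \<in> set vs" for v w
  proof -
    obtain i where "i < length vs" "v = vs ! i" using v by (auto simp: in_set_conv_nth)
    moreover obtain j where "j < length vs" "w = vs ! j" using w by (auto simp: in_set_conv_nth)
    ultimately show ?thesis
      using closed_walk_length_ge[of i "length vs" j "\<lambda>k. u \<bullet> vs ! k"] by (simp add: inner_diff_right)
  qed
  have "u \<bullet> y \<le> u \<bullet> v + ?S / 2" if "v \<in> set vs" for v
    using vertices[OF that] convex_hull_le_inner[of "set vs" u _ y] xy P_eq by blast
  then have "(- u) \<bullet> v \<le> ?S / 2 - u \<bullet> y" if "v \<in> set vs" for v using that by fastforce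
  then have "(- u) \<bullet> x \<le> ?S / 2 - u \<bullet> y"
    using convex_hull_le_inner[of "set vs" "- u" _ x] xy P_eq by blast
  then show ?thesis by (simp add: inner_diff_right)
qed

section \<open>Perimeter and total variation\<close>

text \<open>The last two conjuncts say that the perimeter is \<open>2 * (\<Sum>u\<in>U. c u * width u)\<close>, where
  \<open>width u\<close> is the supremum of \<open>u \<bullet> (y - x)\<close> over \<open>x, y \<in> P\<close>.\<close>

lemma polygon_perimeter_crofton:
  fixes N :: "'v::euclidean_space \<Rightarrow> real"
  assumes dim: "DIM('v) = 2" and N: "is_seminorm N" and W: "finite W"
    and P: "convex_polygon P" "P \<noteq> {}"
  shows "\<exists>U c. finite U \<and> (\<forall>u\<in>U. 0 \<le> c u) \<and> (\<forall>w\<in>W. N w = (\<Sum>u\<in>U. c u * \<bar>u \<bullet> w\<bar>)) \<and>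
    (\<forall>B. (\<forall>u\<in>U. \<exists>x\<in>P. \<exists>y\<in>P. B u \<le> u \<bullet> (y - x)) \<longrightarrow>
      2 * (\<Sum>u\<in>U. c u * B u) \<le> polygon_perimeter N P) \<and>
    (\<forall>B. (\<forall>u\<in>U. \<forall>x\<in>P. \<forall>y\<in>P. u \<bullet> (y - x) \<le> B u) \<longrightarrow>
      polygon_perimeter N P \<le> 2 * (\<Sum>u\<in>U. c u * B u))"
proof -
  define vs where "vs = (SOME vs. cyclic_vertex_list P vs)"
  have vs: "cyclic_vertex_list P vs"
    unfolding vs_def using cyclic_vertex_list_exists[OF dim P(1)] by (rule someI_ex)
  define edge where "edge i = vs ! i - vs ! ((i + length vs - 1) mod length vs)" for i
  \<comment> \<open>One representation must serve the edges of \<open>P\<close>, for the perimeter,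
    as well as \<open>W\<close>, through which sums over \<open>U\<close> are later turned back into
    values of \<open>N\<close>.\<close>
  obtain U c where U: "finite U" "\<And>u. u \<in> U \<Longrightarrow> 0 \<le> c u"
    and crofton: "\<And>w. w \<in> W \<union> edge ` {..<length vs} \<Longrightarrow> N w = (\<Sum>u\<in>U. c u * \<bar>u \<bullet> w\<bar>)"
    using seminorm_finite_crofton[OF dim N, of "W \<union> edge ` {..<length vs}"] W by auto
  define S where "S u = (\<Sum>i<length vs. \<bar>u \<bullet> edge i\<bar>)" for u
  have "polygon_perimeter N P = (\<Sum>i<length vs. N (edge i))"
    by (simp add: polygon_perimeter_def cyclic_sum_def edge_def vs_def)
  also have "\<dots> = (\<Sum>i<length vs. \<Sum>u\<in>U. c u * \<bar>u \<bullet> edge i\<bar>)"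
    using crofton by (intro sum.cong) auto
  also have "\<dots> = (\<Sum>u\<in>U. c u * S u)"
    by (subst sum.swap) (simp add: S_def sum_distrib_left)
  finally have per: "polygon_perimeter N P = (\<Sum>u\<in>U. c u * S u)" .
  have "2 * (\<Sum>u\<in>U. c u * B u) \<le> polygon_perimeter N P"
    if B: "\<forall>u\<in>U. \<exists>x\<in>P. \<exists>y\<in>P. B u \<le> u \<bullet> (y - x)" for B
  proof -
    have "2 * B u \<le> S u" if "u \<in> U" for u
    proof -
      from B that obtain x y where "x \<in> P" "y \<in> P" "B u \<le> u \<bullet> (y - x)" by blast
      with edge_projections_ge[OF P(1) vs, of x y u] show ?thesis by (simp add: S_def edge_def)
    qed
    then have "(\<Sum>u\<in>U. c u * (2 * B u)) \<le> (\<Sum>u\<in>U. c u * S u)"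
      using U(2) by (intro sum_mono mult_left_mono) auto
    then show ?thesis by (simp add: per sum_distrib_left mult.left_commute)
  qed
  moreover have "polygon_perimeter N P \<le> 2 * (\<Sum>u\<in>U. c u * B u)"
    if B: "\<forall>u\<in>U. \<forall>x\<in>P. \<forall>y\<in>P. u \<bullet> (y - x) \<le> B u" for B
  proof -
    have "S u \<le> 2 * B u" if "u \<in> U" for u
      unfolding S_def edge_def using B that by (intro edge_projections_le[OF dim vs _ P(2)]) auto
    then have "(\<Sum>u\<in>U. c u * S u) \<le> (\<Sum>u\<in>U. c u * (2 * B u))"
      using U(2) by (intro sum_mono mult_left_mono) auto
    then show ?thesis by (simp add: per sum_distrib_left mult.left_commute)
  qed
  ultimately show ?thesis using U crofton by (intro exI[of _ U] exI[of _ c] conjI) auto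
qed

text \<open>The width of the zonotope in direction \<open>u\<close> is at least the sum of the
  \<open>\<bar>u \<bullet> w i\<bar>\<close>. Describing it by subset sums suits measures: a sum of
  measures of disjoint sets is the measure of their union.\<close>

lemma sum_le_half_zonotope_perimeter:
  fixes N :: "'v::euclidean_space \<Rightarrow> real" and w :: "nat \<Rightarrow> 'v" and m :: nat
  assumes dim: "DIM('v) = 2" and N: "is_seminorm N"
  defines "Z \<equiv> convex hull ((\<lambda>J. \<Sum>i\<in>J. w i) ` Pow {..<m})"
  shows "2 * (\<Sum>i<m. N (w i)) \<le> polygon_perimeter N Z"
proof -
  have Z: "convex_polygon Z" unfolding convex_polygon_def Z_def by (rule exI, rule conjI[OF _ refl]) simp
  have mem: "(\<Sum>i\<in>J. w i) \<in> Z" if "J \<subseteq> {..<m}" for J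
    unfolding Z_def using that by (intro hull_inc) auto
  then have ne: "Z \<noteq> {}" by blast
  obtain U c where crofton: "\<forall>x\<in>w ` {..<m}. N x = (\<Sum>u\<in>U. c u * \<bar>u \<bullet> x\<bar>)"
    and per: "\<forall>B. (\<forall>u\<in>U. \<exists>x\<in>Z. \<exists>y\<in>Z. B u \<le> u \<bullet> (y - x)) \<longrightarrow>
      2 * (\<Sum>u\<in>U. c u * B u) \<le> polygon_perimeter N Z"
    using polygon_perimeter_crofton[OF dim N _ Z ne, of "w ` {..<m}"] by blast
  have "\<exists>x\<in>Z. \<exists>y\<in>Z. (\<Sum>i<m. \<bar>u \<bullet> w i\<bar>) \<le> u \<bullet> (y - x)" for u
  proof (intro bexI)
    \<comment> \<open>The vectors on the nonnegative side of \<open>u\<close> add up to a point of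
      \<open>Z\<close> where \<open>u\<close> is largest, the remaining ones to a point where it is
      smallest.\<close>
    let ?J = "{i \<in> {..<m}. 0 \<le> u \<bullet> w i}"
    show "(\<Sum>i\<in>?J. w i) \<in> Z" "(\<Sum>i\<in>{..<m} - ?J. w i) \<in> Z" by (auto intro: mem)
    have "(\<Sum>i<m. \<bar>u \<bullet> w i\<bar>) = (\<Sum>i\<in>{..<m} - ?J. \<bar>u \<bullet> w i\<bar>) + (\<Sum>i\<in>?J. \<bar>u \<bullet> w i\<bar>)"
      by (rule sum.subset_diff) auto
    also have "\<dots> = - (\<Sum>i\<in>{..<m} - ?J. u \<bullet> w i) + (\<Sum>i\<in>?J. u \<bullet> w i)"
      unfolding sum_negf[symmetric] by (intro arg_cong2[where f = "(+)"] sum.cong) auto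
    finally show "(\<Sum>i<m. \<bar>u \<bullet> w i\<bar>) \<le> u \<bullet> ((\<Sum>i\<in>?J. w i) - (\<Sum>i\<in>{..<m} - ?J. w i))"
      by (simp add: inner_diff_right inner_sum_right)
  qed
  then have "2 * (\<Sum>u\<in>U. c u * (\<Sum>i<m. \<bar>u \<bullet> w i\<bar>)) \<le> polygon_perimeter N Z"
    by (intro per[rule_format])
  also have "(\<Sum>u\<in>U. c u * (\<Sum>i<m. \<bar>u \<bullet> w i\<bar>)) = (\<Sum>i<m. \<Sum>u\<in>U. c u * \<bar>u \<bullet> w i\<bar>)"
    unfolding sum_distrib_left by (rule sum.swap)
  also have "\<dots> = (\<Sum>i<m. N (w i))" using crofton by (intro sum.cong) auto
  finally show ?thesis .
qed

section \<open>The two inequalities\<close>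

lemma total_variation_le_perimeter:
  fixes N :: "'v::euclidean_space \<Rightarrow> real" and \<mu> :: "'a set \<Rightarrow> 'v"
  assumes dim: "DIM('v) = 2" and N: "is_seminorm N" and \<mu>: "vector_measure X \<Sigma> \<mu>"
  shows "total_variation N \<Sigma> \<mu> A \<le> perimeter N (vm_range \<Sigma> \<mu> A) / 2"
  unfolding total_variation_def
proof (intro SUP_least, clarify)
  fix E :: "nat \<Rightarrow> 'a set" and m :: nat
  assume E: "\<forall>i<m. E i \<in> \<Sigma> \<and> E i \<subseteq> A" and disj: "disjoint_family_on E {..<m}"
  interpret sigma_algebra X \<Sigma> using \<mu> by (simp add: vector_measure_def)
  define S where "S = (\<lambda>J. \<Sum>i\<in>J. \<mu> (E i)) ` Pow {..<m}"
  have "S \<subseteq> {\<mu> E | E. E \<in> \<Sigma> \<and> E \<subseteq> A}"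
  proof
    fix x assume "x \<in> S"
    then obtain J where J: "J \<subseteq> {..<m}" "x = (\<Sum>i\<in>J. \<mu> (E i))" by (auto simp: S_def)
    then have fin: "finite J" by (auto intro: finite_subset)
    have "\<mu> (\<Union>i\<in>J. E i) = x"
      unfolding J(2) using J(1) E fin disjoint_family_on_mono[OF J(1) disj]
      by (intro vector_measure_finite_UN[OF \<mu>]) auto
    moreover have "(\<Union>i\<in>J. E i) \<in> \<Sigma>" "(\<Union>i\<in>J. E i) \<subseteq> A" using J(1) E fin by auto
    ultimately show "x \<in> {\<mu> E | E. E \<in> \<Sigma> \<and> E \<subseteq> A}" by blast
  qed
  then have "convex hull S \<subseteq> vm_range \<Sigma> \<mu> A"
    unfolding vm_range_def using hull_mono[of S _ convex] closure_subset by blast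
  moreover have "convex_polygon (convex hull S)" unfolding convex_polygon_def S_def by (rule exI, rule conjI[OF _ refl]) simp
  ultimately have "ereal (polygon_perimeter N (convex hull S)) \<le> perimeter N (vm_range \<Sigma> \<mu> A)"
    unfolding perimeter_def by (intro SUP_upper) auto
  then have "ereal (polygon_perimeter N (convex hull S)) / 2 \<le> perimeter N (vm_range \<Sigma> \<mu> A) / 2"
    by (rule ereal_divide_right_mono) simp
  moreover have "ereal (\<Sum>i<m. N (\<mu> (E i))) \<le> ereal (polygon_perimeter N (convex hull S)) / 2"
    using sum_le_half_zonotope_perimeter[OF dim N, of "\<lambda>i. \<mu> (E i)" m] by (simp add: S_def)
  ultimately show "ereal (\<Sum>i<m. N (\<mu> (E i))) \<le> perimeter N (vm_range \<Sigma> \<mu> A) / 2" by (rule order_trans[rotated])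
qed

text \<open>This reduces points in the hull of all values of the measure to finitely many measurable
  sets, which have finitely many atoms.\<close>

lemma convex_hull_finite_support:
  assumes "finite T" "T \<subseteq> convex hull M"
  obtains F where "finite F" "F \<subseteq> M" "T \<subseteq> convex hull F"
proof -
  have "\<exists>F. finite F \<and> F \<subseteq> M \<and> t \<in> convex hull F" if "t \<in> T" for t
  proof -
    have "t \<in> convex hull M" using that assms(2) by blast
    then obtain F c where F: "finite F" "F \<subseteq> M" "\<forall>x\<in>F. 0 \<le> c x" "sum c F = 1" "(\<Sum>v\<in>F. c v *\<^sub>R v) = t"
      unfolding convex_hull_explicit by blast
    then have "t \<in> convex hull F" unfolding convex_hull_finite[OF F(1)] by blast
    with F show ?thesis by blast
  qed
  then have "\<forall>t\<in>T. \<exists>F. finite F \<and> F \<subseteq> M \<and> t \<in> convex hull F" by blast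
  from bchoice[OF this] obtain F where F: "\<forall>t\<in>T. finite (F t) \<and> F t \<subseteq> M \<and> t \<in> convex hull F t"
    by blast
  moreover have "convex hull F t \<subseteq> convex hull (\<Union>t\<in>T. F t)" if "t \<in> T" for t
    using that by (intro hull_mono) auto
  ultimately show thesis using assms(1) by (intro that[of "\<Union>t\<in>T. F t"]) auto
qed

text \<open>Only the generating points of \<open>P\<close> are approximated. The error passes to all
  of \<open>P\<close> through linear bounds on \<open>u\<close>, so no nearby polygon has to be
  constructed.\<close>

lemma polygon_perimeter_le_total_variation:
  fixes N :: "'v::euclidean_space \<Rightarrow> real" and \<mu> :: "'a set \<Rightarrow> 'v"
  assumes dim: "DIM('v) = 2" and N: "is_seminorm N" and \<mu>: "vector_measure X \<Sigma> \<mu>"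
    and A: "A \<in> \<Sigma>" and P: "convex_polygon P" "P \<noteq> {}" "P \<subseteq> vm_range \<Sigma> \<mu> A" and "0 < \<epsilon>"
  shows "ereal (polygon_perimeter N P / 2) \<le>
    total_variation N \<Sigma> \<mu> A + ereal (\<epsilon> * (2 * (\<Sum>b\<in>Basis. N b)))"
proof -
  obtain T where T: "finite T" "P = convex hull T" using P(1) by (auto simp: convex_polygon_def)
  define M where "M = \<mu> ` {E. E \<in> \<Sigma> \<and> E \<subseteq> A}"
  have "\<forall>v\<in>T. \<exists>y. y \<in> convex hull M \<and> dist y v < \<epsilon>"
  proof
    fix v assume "v \<in> T"
    then have "v \<in> P" using T(2) by (simp add: hull_inc)
    then have "v \<in> closure (convex hull M)"
      using P(3) by (auto simp: vm_range_def M_def setcompr_eq_image)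
    then show "\<exists>y. y \<in> convex hull M \<and> dist y v < \<epsilon>"
      using \<open>0 < \<epsilon>\<close> by (auto simp: closure_approachable)
  qed
  from bchoice[OF this] obtain y where y: "\<forall>v\<in>T. y v \<in> convex hull M \<and> dist (y v) v < \<epsilon>" by blast
  then have "y ` T \<subseteq> convex hull M" by auto
  then obtain F where F: "finite F" "F \<subseteq> M" "y ` T \<subseteq> convex hull F"
    using convex_hull_finite_support[of "y ` T" M] T(1) by blast
  obtain \<E> where \<E>: "\<E> \<subseteq> {E. E \<in> \<Sigma> \<and> E \<subseteq> A}" "finite \<E>" "F = \<mu> ` \<E>"
    using finite_subset_image[OF F(1) F(2)[unfolded M_def]] by blast
  have \<E>_mem: "\<And>E. E \<in> \<E> \<Longrightarrow> E \<in> \<Sigma> \<and> E \<subseteq> A" using \<E>(1) by blast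
  obtain I :: "'a set set set" and G where I: "finite I" "disjoint_family_on G I"
    and G: "\<And>i. i \<in> I \<Longrightarrow> G i \<in> \<Sigma> \<and> G i \<subseteq> A"
    and atoms: "\<And>E. E \<in> \<E> \<Longrightarrow> \<exists>J\<subseteq>I. \<mu> E = (\<Sum>i\<in>J. \<mu> (G i))"
    using vector_measure_atoms[OF \<mu> A \<E>(2) \<E>_mem] by blast
  \<comment> \<open>\<open>Basis\<close> is included because \<open>norm u\<close> is at most the
    sum of \<open>\<bar>u \<bullet> b\<bar>\<close> over \<open>Basis\<close>: the weighted sum of
    the norms is then bounded by the values \<open>N b\<close>, although \<open>U\<close> and
    \<open>c\<close> vary with \<epsilon>.\<close>
  obtain U c where c: "\<forall>u\<in>U. 0 \<le> c u"
    and crofton: "\<forall>w\<in>(\<lambda>i. \<mu> (G i)) ` I \<union> Basis. N w = (\<Sum>u\<in>U. c u * \<bar>u \<bullet> w\<bar>)"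
    and per: "\<forall>B. (\<forall>u\<in>U. \<forall>x\<in>P. \<forall>y\<in>P. u \<bullet> (y - x) \<le> B u) \<longrightarrow>
      polygon_perimeter N P \<le> 2 * (\<Sum>u\<in>U. c u * B u)"
    using polygon_perimeter_crofton[OF dim N _ P(1,2), of "(\<lambda>i. \<mu> (G i)) ` I \<union> Basis"] I(1)
    by (auto simp del: Un_iff)
  \<comment> \<open>This is the support function of the zonotope spanned by the
    \<open>\<mu> (G i)\<close>: the largest value of \<open>u\<close> on their subset sums.\<close>
  define pos where "pos u = (\<Sum>i\<in>I. max 0 (u \<bullet> \<mu> (G i)))" for u
  have pos: "u \<bullet> x \<le> pos u + \<epsilon> * norm u" if "x \<in> P" for u x
  proof -
    have "u \<bullet> z \<le> pos u" if "z \<in> F" for z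
    proof -
      obtain E where "E \<in> \<E>" "z = \<mu> E" using \<E>(3) \<open>z \<in> F\<close> by blast
      then obtain J where "J \<subseteq> I" "z = (\<Sum>i\<in>J. \<mu> (G i))" using atoms by blast
      then have "u \<bullet> z = (\<Sum>i\<in>J. u \<bullet> \<mu> (G i))" by (simp add: inner_sum_right)
      also have "\<dots> \<le> (\<Sum>i\<in>J. max 0 (u \<bullet> \<mu> (G i)))" by (intro sum_mono) simp
      also have "\<dots> \<le> pos u" unfolding pos_def using I(1) \<open>J \<subseteq> I\<close> by (intro sum_mono2) auto
      finally show ?thesis .
    qed
    then have hull: "u \<bullet> z \<le> pos u" if "z \<in> convex hull F" for z
      using that by (rule convex_hull_le_inner)
    have "u \<bullet> v \<le> pos u + \<epsilon> * norm u" if "v \<in> T" for v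
    proof -
      have "u \<bullet> (v - y v) \<le> norm u * norm (v - y v)" by (rule norm_cauchy_schwarz)
      also have "\<dots> \<le> norm u * \<epsilon>"
        using y that by (intro mult_left_mono) (auto simp: dist_norm norm_minus_commute less_imp_le)
      finally show ?thesis using hull[of "y v"] F(3) that by (auto simp: inner_diff_right mult.commute)
    qed
    then show ?thesis using \<open>x \<in> P\<close> unfolding T(2) by (rule convex_hull_le_inner)
  qed
  \<comment> \<open>The width \<open>pos u + pos (- u)\<close> of the zonotope, enlarged by
    \<open>\<epsilon> * norm u\<close> at either end.\<close>
  define B where "B u = (\<Sum>i\<in>I. \<bar>u \<bullet> \<mu> (G i)\<bar>) + 2 * \<epsilon> * norm u" for u
  have "u \<bullet> (y - x) \<le> B u" if "x \<in> P" "y \<in> P" for u x y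
  proof -
    have "pos u + pos (- u) = (\<Sum>i\<in>I. \<bar>u \<bullet> \<mu> (G i)\<bar>)"
      unfolding pos_def sum.distrib[symmetric] by (intro sum.cong) auto
    then show ?thesis using pos[of y u] pos[of x "- u"] that by (simp add: B_def inner_diff_right)
  qed
  then have "polygon_perimeter N P \<le> 2 * (\<Sum>u\<in>U. c u * B u)" by (intro per[rule_format])
  then have "polygon_perimeter N P / 2 \<le> (\<Sum>u\<in>U. c u * B u)" by simp
  also have "\<dots> = (\<Sum>u\<in>U. c u * (\<Sum>i\<in>I. \<bar>u \<bullet> \<mu> (G i)\<bar>)) + 2 * \<epsilon> * (\<Sum>u\<in>U. c u * norm u)"
    unfolding B_def distrib_left sum.distrib by (simp add: sum_distrib_left mult_ac)
  finally have le: "polygon_perimeter N P / 2 \<le>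
      (\<Sum>u\<in>U. c u * (\<Sum>i\<in>I. \<bar>u \<bullet> \<mu> (G i)\<bar>)) + 2 * \<epsilon> * (\<Sum>u\<in>U. c u * norm u)" .
  have "(\<Sum>u\<in>U. c u * (\<Sum>i\<in>I. \<bar>u \<bullet> \<mu> (G i)\<bar>)) = (\<Sum>i\<in>I. \<Sum>u\<in>U. c u * \<bar>u \<bullet> \<mu> (G i)\<bar>)"
    unfolding sum_distrib_left by (rule sum.swap)
  also have "\<dots> = (\<Sum>i\<in>I. N (\<mu> (G i)))" using crofton by (intro sum.cong) auto
  finally have N_sum: "(\<Sum>u\<in>U. c u * (\<Sum>i\<in>I. \<bar>u \<bullet> \<mu> (G i)\<bar>)) = (\<Sum>i\<in>I. N (\<mu> (G i)))" .
  have "(\<Sum>u\<in>U. c u * norm u) \<le> (\<Sum>u\<in>U. c u * (\<Sum>b\<in>Basis. \<bar>u \<bullet> b\<bar>))"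
    using c by (intro sum_mono mult_left_mono norm_le_l1) auto
  also have "\<dots> = (\<Sum>b\<in>Basis. \<Sum>u\<in>U. c u * \<bar>u \<bullet> b\<bar>)"
    unfolding sum_distrib_left by (rule sum.swap)
  also have "\<dots> = (\<Sum>b\<in>Basis. N b)" using crofton by (intro sum.cong) auto
  finally have "2 * \<epsilon> * (\<Sum>u\<in>U. c u * norm u) \<le> 2 * \<epsilon> * (\<Sum>b\<in>Basis. N b)"
    using \<open>0 < \<epsilon>\<close> by simp
  with le N_sum have "polygon_perimeter N P / 2 \<le> (\<Sum>i\<in>I. N (\<mu> (G i))) + 2 * \<epsilon> * (\<Sum>b\<in>Basis. N b)"
    by simp
  then have "ereal (polygon_perimeter N P / 2) \<le>
      ereal (\<Sum>i\<in>I. N (\<mu> (G i))) + ereal (\<epsilon> * (2 * (\<Sum>b\<in>Basis. N b)))"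
    by (simp add: mult_ac)
  also have "\<dots> \<le> total_variation N \<Sigma> \<mu> A + ereal (\<epsilon> * (2 * (\<Sum>b\<in>Basis. N b)))"
    using total_variation_ge_sum[OF I G, of N \<mu>] by (intro add_right_mono) auto
  finally show ?thesis .
qed

lemma perimeter_le_total_variation:
  fixes N :: "'v::euclidean_space \<Rightarrow> real" and \<mu> :: "'a set \<Rightarrow> 'v"
  assumes dim: "DIM('v) = 2" and N: "is_seminorm N" and \<mu>: "vector_measure X \<Sigma> \<mu>" and A: "A \<in> \<Sigma>"
  shows "perimeter N (vm_range \<Sigma> \<mu> A) / 2 \<le> total_variation N \<Sigma> \<mu> A"
proof -
  have "ereal (polygon_perimeter N P) \<le> 2 * total_variation N \<Sigma> \<mu> A"
    if P: "convex_polygon P" "P \<subseteq> vm_range \<Sigma> \<mu> A" for P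
  proof -
    have "ereal (polygon_perimeter N P / 2) \<le> total_variation N \<Sigma> \<mu> A"
    proof (cases "P = {}")
      \<comment> \<open>The width estimates need a point of \<open>P\<close>. The empty polygon has
        no vertices and perimeter 0, and the empty family of sets shows that the total variation is
        nonnegative.\<close>
      case True
      have "set (SOME vs. cyclic_vertex_list P vs) = {}"
        using someI_ex[OF cyclic_vertex_list_exists[OF dim P(1)]] True
        by (simp add: cyclic_vertex_list_def extreme_point_of_def)
      then have "polygon_perimeter N P = 0" by (simp add: polygon_perimeter_def cyclic_sum_def)
      then show ?thesis using total_variation_ge_sum[of "{}" undefined \<Sigma> A N \<mu>]
        by (simp add: disjoint_family_on_def zero_ereal_def)
    next
      case False
      define K where "K = 2 * (\<Sum>b\<in>Basis. N b)"
      have "0 \<le> K" using seminorm_nonneg[OF N] by (simp add: K_def sum_nonneg)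
      show ?thesis
      proof (rule ereal_le_epsilon2)
        fix e :: real assume "0 < e"
        \<comment> \<open>\<open>K\<close> vanishes when \<open>N\<close> does, hence the
          denominator \<open>K + 1\<close>.\<close>
        define \<epsilon> where "\<epsilon> = e / (K + 1)"
        have "0 < \<epsilon>" "\<epsilon> * K \<le> e" using \<open>0 < e\<close> \<open>0 \<le> K\<close> by (auto simp: \<epsilon>_def field_simps)
        then have "total_variation N \<Sigma> \<mu> A + ereal (\<epsilon> * K) \<le> total_variation N \<Sigma> \<mu> A + ereal e"
          by (intro add_left_mono) simp
        then show "ereal (polygon_perimeter N P / 2) \<le> total_variation N \<Sigma> \<mu> A + ereal e"
          using polygon_perimeter_le_total_variation[OF dim N \<mu> A P(1) False P(2) \<open>0 < \<epsilon>\<close>]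
          unfolding K_def by (rule order_trans[rotated])
      qed
    qed
    then show ?thesis
      by (cases "total_variation N \<Sigma> \<mu> A") auto
  qed
  then have "perimeter N (vm_range \<Sigma> \<mu> A) \<le> 2 * total_variation N \<Sigma> \<mu> A"
    unfolding perimeter_def by (intro SUP_least) auto
  then show ?thesis by (simp add: ereal_divide_le_pos)
qed

theorem theorem1p6:
  fixes N :: "'v::euclidean_space \<Rightarrow> real"
    and X :: "'a set" and \<Sigma> :: "'a set set" and \<mu> :: "'a set \<Rightarrow> 'v"
  assumes "DIM('v) = 2"
    and "is_seminorm N"
    and "vector_measure X \<Sigma> \<mu>"
  shows "total_variation N \<Sigma> \<mu> X = perimeter N (vm_range \<Sigma> \<mu> X) / 2
         \<and> (\<forall>A\<in>\<Sigma>. total_variation N \<Sigma> \<mu> A = perimeter N (vm_range \<Sigma> \<mu> A) / 2)"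
proof -
  interpret sigma_algebra X \<Sigma> using assms(3) by (simp add: vector_measure_def)
  have "total_variation N \<Sigma> \<mu> A = perimeter N (vm_range \<Sigma> \<mu> A) / 2" if "A \<in> \<Sigma>" for A
    using total_variation_le_perimeter[OF assms] perimeter_le_total_variation[OF assms that]
    by (rule antisym)
  then show ?thesis by blast
qed

end
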